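(* Let $A=(a_{ij})$ be a real $n\times n$ matrix which is both a Robinson matrix and a Kalmanson matrix, and let $B=(b_{ij})$ be an $n\times n$ down-benevolent Toeplitz matrix. Then the identity permutation is an optimal solution of $QAP(A,B)$, i.e. for every permutation $\pi$ of $\{1,\ldots,n\}$, $$\sum_{i=1}^n\sum_{j=1}^n a_{ij}\,b_{ij}\;\le\;\sum_{i=1}^n\sum_{j=1}^n a_{\pi(i)\pi(j)}\,b_{ij}.$$
   Context: $QAP(A,B)$: for real $n\times n$ matrices $A=(a_{ij})$, $B=(b_{ij})$, minimize $Z_\pi(A,B)=\sum_{i=1}^n\sum_{j=1}^n a_{\pi(i)\pi(j)}b_{ij}$ over all permutations $\pi$ of $\{1,\ldots,n\}$. A symmetric matrix $A=(a_{ij})$ is a Robinson matrix if $a_{ik}\ge\max\{a_{ij},a_{jk}\}$ for all $i<j<k$. A symmetric $n\times n$ matrix $(c_{ij})$ is a Kalmanson matrix if $c_{ij}+c_{kl}\le c_{ik}+c_{jl}$ and $c_{ik}+c_{jl}\ge c_{il}+c_{jk}$ for all $1\le i<j<k<l\le n$. A Toeplitz matrix with generating function $f\colon\{-n+1,\ldots,n-1\}\to\mathbb{R}$ is the $n\times n$ matrix with $b_{ij}=f(i-j)$. A down-benevolent Toeplitz matrix is a symmetric $n\times n$ Toeplitz matrix whose generating function $f$ satisfies $f(0)=0$, $f(1)\ge f(2)\ge\cdots\ge f(\lceil\frac{n-1}{2}\rceil)$, and $f(i)\ge f(n-i)$ for all $1\le i\le\lceil\frac{n-1}{2}\rceil$.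 *)

theory Defs
  imports Complex_Main "HOL-Combinatorics.Permutations"
begin

text \<open>A real \<open>n \<times> n\<close> matrix is represented by a function \<^typ>\<open>nat \<Rightarrow> nat \<Rightarrow> real\<close> of which only
  the entries with both indices in \<open>{1..n}\<close> are relevant.\<close>

definition qap_cost :: "nat \<Rightarrow> (nat \<Rightarrow> nat \<Rightarrow> real) \<Rightarrow> (nat \<Rightarrow> nat \<Rightarrow> real) \<Rightarrow> (nat \<Rightarrow> nat) \<Rightarrow> real" where
  "qap_cost n A B \<pi> = (\<Sum>i=1..n. \<Sum>j=1..n. A (\<pi> i) (\<pi> j) * B i j)"

definition qap_optimal :: "nat \<Rightarrow> (nat \<Rightarrow> nat \<Rightarrow> real) \<Rightarrow> (nat \<Rightarrow> nat \<Rightarrow> real) \<Rightarrow> (nat \<Rightarrow> nat) \<Rightarrow> bool" where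
  "qap_optimal n A B \<pi> \<longleftrightarrow>
     \<pi> permutes {1..n} \<and> (\<forall>\<sigma>. \<sigma> permutes {1..n} \<longrightarrow> qap_cost n A B \<pi> \<le> qap_cost n A B \<sigma>)"

definition symmetric_matrix :: "nat \<Rightarrow> (nat \<Rightarrow> nat \<Rightarrow> real) \<Rightarrow> bool" where
  "symmetric_matrix n A \<longleftrightarrow> (\<forall>i\<in>{1..n}. \<forall>j\<in>{1..n}. A i j = A j i)"

definition robinson_matrix :: "nat \<Rightarrow> (nat \<Rightarrow> nat \<Rightarrow> real) \<Rightarrow> bool" where
  "robinson_matrix n A \<longleftrightarrow> symmetric_matrix n A \<and>
     (\<forall>i j k. 1 \<le> i \<and> i < j \<and> j < k \<and> k \<le> n \<longrightarrow> A i k \<ge> max (A i j) (A j k))"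

definition kalmanson_matrix :: "nat \<Rightarrow> (nat \<Rightarrow> nat \<Rightarrow> real) \<Rightarrow> bool" where
  "kalmanson_matrix n C \<longleftrightarrow> symmetric_matrix n C \<and>
     (\<forall>i j k l. 1 \<le> i \<and> i < j \<and> j < k \<and> k < l \<and> l \<le> n \<longrightarrow>
        C i j + C k l \<le> C i k + C j l \<and> C i k + C j l \<ge> C i l + C j k)"

text \<open>Only the values of the generating function \<open>f\<close> on \<open>{-n+1..n-1}\<close> are relevant.\<close>

definition toeplitz_matrix :: "nat \<Rightarrow> (int \<Rightarrow> real) \<Rightarrow> (nat \<Rightarrow> nat \<Rightarrow> real) \<Rightarrow> bool" where
  "toeplitz_matrix n f B \<longleftrightarrow> (\<forall>i\<in>{1..n}. \<forall>j\<in>{1..n}. B i j = f (int i - int j))"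

definition down_benevolent_function :: "nat \<Rightarrow> (int \<Rightarrow> real) \<Rightarrow> bool" where
  "down_benevolent_function n f \<longleftrightarrow> f 0 = 0 \<and>
     (\<forall>i. 1 \<le> i \<and> i + 1 \<le> \<lceil>(real n - 1) / 2\<rceil> \<longrightarrow> f i \<ge> f (i + 1)) \<and>
     (\<forall>i. 1 \<le> i \<and> i \<le> \<lceil>(real n - 1) / 2\<rceil> \<longrightarrow> f i \<ge> f (int n - i))"

definition down_benevolent_toeplitz :: "nat \<Rightarrow> (nat \<Rightarrow> nat \<Rightarrow> real) \<Rightarrow> bool" where
  "down_benevolent_toeplitz n B \<longleftrightarrow> symmetric_matrix n B \<and>
     (\<exists>f. toeplitz_matrix n f B \<and> down_benevolent_function n f)"

end

theory Submission
  imports Defs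
begin

text \<open>A Robinson Kalmanson matrix is, off the diagonal, a constant minus a combination with
  nonnegative weights of the 0/1 matrices that mark the pairs lying in a common interval
  \<open>{a..b}\<close>: the weights are mixed second differences, and the Kalmanson inequality (in the
  interior) and the Robinson inequality (at the border) say exactly that they are nonnegative
  (\<open>robinson_kalmanson_interval_decomposition\<close>).  Hence, up to a constant, \<open>qap_cost n A B \<sigma>\<close>
  is minus a combination of the sums of \<open>B\<close> over the pairs of distinct elements of the sets
  \<open>\<sigma> -` {a..b}\<close>.  The claim reduces to a statement about \<open>B\<close> alone: among all
  subsets of \<open>{1..n}\<close> of a given size, the intervals maximise the sum of \<open>B\<close> over pairs
  (\<open>pair_sum_interval_max\<close>).  Since \<open>B\<close> is Toeplitz, it does not matter where the
  interval lies.

  Summation by parts reduces this to counting.  The value of a down-benevolent function at a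
  distance \<open>d\<close> is a nonnegative combination of the indicators that the cyclic distance
  \<open>min d (n - d)\<close> is at most \<open>h\<close>, where \<open>2 * h < n\<close>, plus a constant,
  minus a nonnegative combination of the indicators of single distances
  \<open>d \<ge> n / 2\<close> (\<open>benevolent_decomposition\<close>).  A set of size \<open>s\<close> contains at least
  \<open>s - d\<close> pairs at such a distance \<open>d\<close>, by the pigeonhole principle, and an interval
  contains no more (\<open>gap_pairs_interval_min\<close>).

  What remains is the edge-isoperimetric problem for powers of a cycle: intervals maximise the
  number of pairs at cyclic distance at most \<open>h\<close> (\<open>near_pairs_interval_max\<close>).  Three
  observations solve it.  Deleting points of the cycle outside \<open>S\<close> only brings the points of
  \<open>S\<close> closer together, so it cannot destroy a near pair.  Since every point has exactly
  \<open>h\<close> near successors and \<open>h\<close> near predecessors, the numbers of near pairs in a set and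
  in its complement determine each other.  And a set of size \<open>k\<close> has at most
  \<open>k * (k - 1) / 2\<close> near pairs.  If \<open>S\<close> has at most
  \<open>h + 1\<close> elements, the last bound is already the number for an interval.  Otherwise one
  deletes points outside \<open>S\<close> until at most \<open>h\<close> are left, passes to the complement, and
  applies that bound there.\<close>

section \<open>Arcs of a cyclically ordered finite set\<close>

text \<open>The cyclic order is that of \<open>\<nat>\<close> closed up at infinity; an arc contains its start
  and not its end.\<close>

definition arc :: "nat \<Rightarrow> nat \<Rightarrow> nat set" where
  "arc u v = (if u \<le> v then {u..<v} else - {v..<u})"

text \<open>Distances are counted in points of \<open>V\<close>, walking from \<open>u\<close> in the increasing direction.
  As the cycle is an arbitrary set of numbers, deleting a point of it needs no renumbering.\<close>

definition cyc_dist :: "nat set \<Rightarrow> nat \<Rightarrow> nat \<Rightarrow> nat" where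
  "cyc_dist V u v = card (V \<inter> arc u v)"

definition near_pairs :: "nat set \<Rightarrow> nat \<Rightarrow> nat set \<Rightarrow> nat set \<Rightarrow> (nat \<times> nat) set" where
  "near_pairs V h S T = {(u, v). u \<in> S \<and> v \<in> T \<and> u \<noteq> v \<and> cyc_dist V u v \<le> h}"

definition offdiag :: "nat set \<Rightarrow> (nat \<times> nat) set" where
  "offdiag S = {(u, v). u \<in> S \<and> v \<in> S \<and> u \<noteq> v}"

lemma finite_offdiag [simp]: "finite S \<Longrightarrow> finite (offdiag S)"
  by (rule finite_subset[of _ "S \<times> S"]) (auto simp: offdiag_def)

lemma card_offdiag:
  assumes "finite S"
  shows "card (offdiag S) = card S * (card S - 1)"
proof -
  have "offdiag S = S \<times> S - (\<lambda>u. (u, u)) ` S"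
    by (auto simp: offdiag_def)
  moreover have "card ((\<lambda>u. (u, u)) ` S) = card S"
    by (rule card_image) (auto simp: inj_on_def)
  ultimately show ?thesis
    using assms by (subst \<open>offdiag S = _\<close>, subst card_Diff_subset)
      (auto simp: card_cartesian_product diff_mult_distrib2)
qed

lemma mem_swap_image: "(u, v) \<in> prod.swap ` X \<longleftrightarrow> (v, u) \<in> X"
  by force

lemma finite_near_pairs [simp]:
  "finite S \<Longrightarrow> finite T \<Longrightarrow> finite (near_pairs V h S T)"
  by (rule finite_subset[of _ "S \<times> T"]) (auto simp: near_pairs_def)

lemma cyc_dist_add:
  assumes "finite V" "u \<noteq> v"
  shows "cyc_dist V u v + cyc_dist V v u = card V"
proof -
  have "arc v u = - arc u v"
    using assms(2) by (auto simp: arc_def)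
  then show ?thesis
    unfolding cyc_dist_def using card_Int_Diff[OF assms(1), of "arc u v"]
    by (simp add: Diff_eq)
qed

lemma cyc_dist_mono:
  assumes "finite V" "V' \<subseteq> V"
  shows "cyc_dist V' u v \<le> cyc_dist V u v"
  unfolding cyc_dist_def using assms by (intro card_mono) auto

text \<open>Of two distinct end points one is met before the other on the way from \<open>u\<close>, so the
  distances from \<open>u\<close> are pairwise distinct.  This makes the near-pair graph regular.\<close>

lemma cyc_dist_bij:
  assumes V: "finite V" and u: "u \<in> V"
  shows "bij_betw (cyc_dist V u) V {0..<card V}"
proof -
  have ne: "cyc_dist V u v \<noteq> cyc_dist V u w"
    if "v \<in> V" "w \<in> V" "v \<in> arc u w" for v w
  proof -
    have "V \<inter> arc u v \<subseteq> V \<inter> arc u w"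
      using that(3) by (auto simp: arc_def split: if_splits)
    moreover have "v \<notin> arc u v" by (simp add: arc_def)
    ultimately have "V \<inter> arc u v \<subset> V \<inter> arc u w"
      using that by (metis IntD2 IntI psubsetI)
    then have "card (V \<inter> arc u v) < card (V \<inter> arc u w)"
      using V by (intro psubset_card_mono) simp
    then show ?thesis by (simp add: cyc_dist_def)
  qed
  have "v \<in> arc u w \<or> w \<in> arc u v" if "v \<noteq> w" for v w
    using that by (auto simp: arc_def)
  with ne have inj: "inj_on (cyc_dist V u) V"
    unfolding inj_on_def by metis
  have "cyc_dist V u v < card V" if "v \<in> V" for v
  proof -
    have "v \<notin> arc u v" by (simp add: arc_def)
    with that have "V \<inter> arc u v \<subset> V" by blast
    then show ?thesis unfolding cyc_dist_def by (rule psubset_card_mono[OF V])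
  qed
  then have "cyc_dist V u ` V \<subseteq> {0..<card V}" by auto
  then have "cyc_dist V u ` V = {0..<card V}"
    using card_image[OF inj] by (intro card_subset_eq) auto
  with inj show ?thesis by (simp add: bij_betw_def)
qed

lemma cyc_dist_self [simp]: "cyc_dist V u u = 0"
  by (simp add: cyc_dist_def arc_def)

lemma cyc_dist_eq_0: "u \<in> V \<Longrightarrow> finite V \<Longrightarrow> v \<in> V \<Longrightarrow> cyc_dist V u v = 0 \<longleftrightarrow> u = v"
  unfolding cyc_dist_def by (auto simp: arc_def split: if_splits)

lemma card_cyc_dist_vimage:
  assumes "finite V" "u \<in> V" "D \<subseteq> {0..<card V}"
  shows "card {v \<in> V. cyc_dist V u v \<in> D} = card D"
proof -
  have "cyc_dist V u ` {v \<in> V. cyc_dist V u v \<in> D} = cyc_dist V u ` V \<inter> D"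
    by blast
  also have "\<dots> = D"
    using cyc_dist_bij[OF assms(1,2)] assms(3) by (simp add: bij_betw_def Int_absorb1)
  finally have "bij_betw (cyc_dist V u) {v \<in> V. cyc_dist V u v \<in> D} D"
    using cyc_dist_bij[OF assms(1,2)] by (auto simp: bij_betw_def intro: inj_on_subset)
  then show ?thesis by (rule bij_betw_same_card)
qed

lemma card_out_near:
  assumes "finite V" "h < card V" "u \<in> V"
  shows "card {v \<in> V. u \<noteq> v \<and> cyc_dist V u v \<le> h} = h"
proof -
  have "{v \<in> V. u \<noteq> v \<and> cyc_dist V u v \<le> h} = {v \<in> V. cyc_dist V u v \<in> {1..h}}"
    using cyc_dist_eq_0[OF assms(3,1)] by (auto simp: Suc_le_eq)
  moreover have "{1..h} \<subseteq> {0..<card V}" using assms(2) by auto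
  ultimately show ?thesis
    using card_cyc_dist_vimage[OF assms(1,3), of "{1..h}"] by simp
qed

text \<open>By \<open>cyc_dist_add\<close>, the near predecessors of \<open>v\<close> are the points at distance at least
  \<open>card V - h\<close> from \<open>v\<close>.\<close>

lemma card_in_near:
  assumes "finite V" "h < card V" "v \<in> V"
  shows "card {u \<in> V. u \<noteq> v \<and> cyc_dist V u v \<le> h} = h"
proof -
  have "{u \<in> V. u \<noteq> v \<and> cyc_dist V u v \<le> h}
      = {u \<in> V. cyc_dist V v u \<in> {card V - h..<card V}}" (is "?L = ?R")
  proof (intro set_eqI iffI)
    fix u assume u: "u \<in> ?L"
    then have "cyc_dist V v u < card V"
      using bij_betwE[OF cyc_dist_bij[OF assms(1,3)]] by auto
    then show "u \<in> ?R"
      using u cyc_dist_add[OF assms(1), of u v] by auto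
  next
    fix u assume u: "u \<in> ?R"
    with assms(2) have "cyc_dist V v u \<noteq> 0" by auto
    with u have "u \<noteq> v" using cyc_dist_eq_0[OF assms(3,1,3)] by auto
    then show "u \<in> ?L"
      using u cyc_dist_add[OF assms(1), of u v] by auto
  qed
  moreover have "{card V - h..<card V} \<subseteq> {0..<card V}" by auto
  ultimately show ?thesis
    using card_cyc_dist_vimage[OF assms(1,3), of "{card V - h..<card V}"] assms(2) by simp
qed

section \<open>Intervals maximise the number of near pairs\<close>

lemma card_near_pairs_from:
  assumes "finite V" "h < card V" "S \<subseteq> V"
  shows "card (near_pairs V h S V) = h * card S"
proof -
  have "near_pairs V h S V = Sigma S (\<lambda>u. {v \<in> V. u \<noteq> v \<and> cyc_dist V u v \<le> h})"
    by (auto simp: near_pairs_def)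
  moreover have "\<forall>u\<in>S. card {v \<in> V. u \<noteq> v \<and> cyc_dist V u v \<le> h} = h"
    using card_out_near[OF assms(1,2)] assms(3) by auto
  ultimately show ?thesis
    using assms finite_subset[OF assms(3,1)] by (simp add: card_SigmaI)
qed

lemma card_near_pairs_to:
  assumes "finite V" "h < card V" "T \<subseteq> V"
  shows "card (near_pairs V h V T) = h * card T"
proof -
  have "near_pairs V h V T
      = prod.swap ` Sigma T (\<lambda>v. {u \<in> V. u \<noteq> v \<and> cyc_dist V u v \<le> h})"
    by (intro set_eqI, clarify) (auto simp only: mem_swap_image near_pairs_def mem_Sigma_iff
        mem_Collect_eq case_prod_conv)
  moreover have "\<forall>v\<in>T. card {u \<in> V. u \<noteq> v \<and> cyc_dist V u v \<le> h} = h"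
    using card_in_near[OF assms(1,2)] assms(3) by auto
  ultimately show ?thesis
    using assms finite_subset[OF assms(3,1)] by (simp add: card_SigmaI card_image)
qed

text \<open>Near pairs leading from \<open>S\<close> to its complement are counted once by their start, as
  the pairs starting in \<open>S\<close> less those inside \<open>S\<close>, and once by their end.\<close>

lemma card_near_pairs_complement:
  assumes "finite V" "h < card V" "S \<subseteq> V"
  shows "card (near_pairs V h S S) + h * card (V - S)
       = h * card S + card (near_pairs V h (V - S) (V - S))"
proof -
  note fin = finite_subset[OF assms(3,1)] assms(1)
  have "near_pairs V h S V = near_pairs V h S S \<union> near_pairs V h S (V - S)"
    using assms(3) by (auto simp: near_pairs_def)
  moreover have "near_pairs V h S S \<inter> near_pairs V h S (V - S) = {}"
    by (auto simp: near_pairs_def)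
  ultimately have 1: "h * card S = card (near_pairs V h S S) + card (near_pairs V h S (V - S))"
    using card_near_pairs_from[OF assms] fin
      card_Un_disjoint[of "near_pairs V h S S" "near_pairs V h S (V - S)"] by simp
  have "near_pairs V h V (V - S) = near_pairs V h S (V - S) \<union> near_pairs V h (V - S) (V - S)"
    using assms(3) by (auto simp: near_pairs_def)
  moreover have "near_pairs V h S (V - S) \<inter> near_pairs V h (V - S) (V - S) = {}"
    by (auto simp: near_pairs_def)
  ultimately have "h * card (V - S)
      = card (near_pairs V h S (V - S)) + card (near_pairs V h (V - S) (V - S))"
    using card_near_pairs_to[OF assms(1,2), of "V - S"] fin
      card_Un_disjoint[of "near_pairs V h S (V - S)" "near_pairs V h (V - S) (V - S)"] by simp
  with 1 show ?thesis by simp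
qed

text \<open>The two distances between distinct points add up to \<open>card V > 2 * h\<close>, so at most one of
  them is at most \<open>h\<close>: a pair is near in one direction only.\<close>

lemma near_pairs_swap_disjoint:
  assumes "finite V" "2 * h < card V"
  shows "near_pairs V h S S \<inter> prod.swap ` near_pairs V h S S = {}"
proof -
  have False if "u \<noteq> v" "cyc_dist V u v \<le> h" "cyc_dist V v u \<le> h" for u v
    using cyc_dist_add[OF assms(1) that(1)] that assms(2) by simp
  then show ?thesis
    by (intro equals0I, clarsimp simp: mem_swap_image near_pairs_def) auto
qed

lemma card_near_pairs_sym:
  assumes "finite V" "2 * h < card V" "finite S"
  shows "card (near_pairs V h S S \<union> prod.swap ` near_pairs V h S S)
       = 2 * card (near_pairs V h S S)"
  using near_pairs_swap_disjoint[OF assms(1,2), of S] assms(3)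
  by (simp add: card_Un_disjoint card_image)

lemma near_pairs_le_all:
  assumes "finite V" "2 * h < card V" "finite S"
  shows "2 * card (near_pairs V h S S) \<le> card S * (card S - 1)"
proof -
  have "near_pairs V h S S \<union> prod.swap ` near_pairs V h S S \<subseteq> offdiag S"
    by (auto simp: near_pairs_def offdiag_def)
  then show ?thesis
    using card_mono[of "offdiag S"] assms
    by (metis card_near_pairs_sym card_offdiag finite_offdiag)
qed

text \<open>A short arc attains the bound \<open>near_pairs_le_all\<close>, since one can walk between any two of
  its points without leaving it.  The hypothesis on arcs is phrased so that it also covers the
  complement of an interval, which wraps around.\<close>

lemma near_pairs_short_arc:
  assumes "finite V" "2 * h < card V" "S \<subseteq> V" "card S \<le> h + 1"
    and arc: "\<And>u v. u \<in> S \<Longrightarrow> v \<in> S \<Longrightarrow> u < v \<Longrightarrow>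
               V \<inter> arc u v \<subseteq> S \<or> V \<inter> arc v u \<subseteq> S"
  shows "2 * card (near_pairs V h S S) = card S * (card S - 1)"
proof -
  have finS: "finite S" using assms finite_subset by blast
  have short: "cyc_dist V u v \<le> h" if "u \<in> S" "v \<in> S" "V \<inter> arc u v \<subseteq> S" for u v
  proof -
    have "V \<inter> arc u v \<subseteq> S - {v}"
      using that by (auto simp: arc_def split: if_splits)
    then have "cyc_dist V u v \<le> card (S - {v})"
      unfolding cyc_dist_def using finS by (intro card_mono) auto
    then show ?thesis using that assms(4) by simp
  qed
  have "cyc_dist V u v \<le> h \<or> cyc_dist V v u \<le> h" if "u \<in> S" "v \<in> S" "u \<noteq> v" for u v
    using that arc[of u v] arc[of v u] short by (cases "u < v") auto
  then have "near_pairs V h S S \<union> prod.swap ` near_pairs V h S S = offdiag S"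
    by (intro set_eqI, clarify) (auto simp: mem_swap_image near_pairs_def offdiag_def)
  then show ?thesis
    using card_near_pairs_sym[OF assms(1,2) finS] card_offdiag[OF finS] by simp
qed

text \<open>Deleting points of the cycle does not increase distances.\<close>

lemma near_pairs_mono:
  assumes "finite V" "V' \<subseteq> V"
  shows "near_pairs V h S T \<subseteq> near_pairs V' h S T"
  using cyc_dist_mono[OF assms] by (auto simp: near_pairs_def intro: le_trans)

text \<open>The heart of the isoperimetric inequality: keep only \<open>k\<close> of the points outside \<open>S\<close>,
  pass to the complement of \<open>S\<close> in the smaller cycle, and use the trivial bound on these
  \<open>k\<close> points.\<close>

lemma near_pairs_complement_bound:
  assumes "finite V" "S \<subseteq> V" "k \<le> card (V - S)" "2 * h < card S + k"
  shows "2 * card (near_pairs V h S S) + 2 * (h * k) \<le> 2 * (h * card S) + k * (k - 1)"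
proof -
  obtain T where T: "T \<subseteq> V - S" "card T = k" "finite T"
    using obtain_subset_with_card_n[OF assms(3)] by auto
  have finS: "finite S" using assms finite_subset by blast
  let ?V = "S \<union> T"
  have "S \<inter> T = {}" and diff: "?V - S = T" using T by blast+
  then have card: "card ?V = card S + k"
    using T finS by (simp add: card_Un_disjoint)
  have fin: "finite ?V" using finS T by simp
  have "card (near_pairs V h S S) \<le> card (near_pairs ?V h S S)"
    using assms T finS by (intro card_mono near_pairs_mono) auto
  moreover have "card (near_pairs ?V h S S) + h * k = h * card S + card (near_pairs ?V h T T)"
    using card_near_pairs_complement[OF fin, of h S] card diff T assms(4) by simp
  moreover have "2 * card (near_pairs ?V h T T) \<le> k * (k - 1)"
    using near_pairs_le_all[OF fin, of h T] T card assms(4) by simp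
  ultimately show ?thesis by linarith
qed

text \<open>If \<open>S\<close> or its complement is small, the interval or its complement is a short arc and
  attains the trivial bound.  Otherwise \<open>near_pairs_complement_bound\<close> with \<open>k = h\<close> is
  sharp for intervals.\<close>

lemma near_pairs_interval_max:
  assumes h: "2 * h < n" and ab: "1 \<le> a" "a \<le> b" "b \<le> n"
    and S: "S \<subseteq> {1..n}" "card S = card {a..b}"
  shows "card (near_pairs {1..n} h S S) \<le> card (near_pairs {1..n} h {a..b} {a..b})"
proof -
  let ?V = "{1..n}" and ?I = "{a..b}"
  let ?N = "\<lambda>S. card (near_pairs {1..n} h S S)"
  define s where "s = card ?I"
  have s: "s = b + 1 - a" "card S = s" "s \<le> n" using ab S by (auto simp: s_def)
  have finS: "finite S" using S finite_subset by blast
  have V: "finite ?V" "2 * h < card ?V" "h < card ?V" using h by auto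
  have IV: "?I \<subseteq> ?V" using ab by auto
  have co: "card (?V - S) = n - s" "card (?V - ?I) = n - s"
    using S IV s finS by (simp_all add: card_Diff_subset)
  consider "s \<le> h + 1" | "h + 1 < s" "n - s \<le> h" | "h + 1 < s" "h < n - s" by linarith
  then show ?thesis
  proof cases
    case 1
    have "?V \<inter> arc u v \<subseteq> ?I" if "u \<in> ?I" "v \<in> ?I" "u < v" for u v
      using that by (auto simp: arc_def)
    then have "2 * ?N ?I = s * (s - 1)"
      unfolding s_def using 1 by (intro near_pairs_short_arc[OF V(1,2) IV]) (auto simp: s_def)
    moreover have "2 * ?N S \<le> s * (s - 1)"
      using near_pairs_le_all[OF V(1,2) finS] s by simp
    ultimately show ?thesis by simp
  next
    case 2
    have "?V \<inter> arc u v \<subseteq> ?V - ?I \<or> ?V \<inter> arc v u \<subseteq> ?V - ?I"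
      if "u \<in> ?V - ?I" "v \<in> ?V - ?I" "u < v" for u v
      using that by (cases "v < a \<or> b < u") (auto simp: arc_def)
    then have "2 * ?N (?V - ?I) = (n - s) * (n - s - 1)"
      using near_pairs_short_arc[OF V(1,2), of "?V - ?I"] co 2 by auto
    moreover have "2 * ?N (?V - S) \<le> (n - s) * (n - s - 1)"
      using near_pairs_le_all[OF V(1,2), of "?V - S"] co by simp
    moreover have "?N ?I + h * (n - s) = h * s + ?N (?V - ?I)"
      using card_near_pairs_complement[OF V(1,3) IV] co s_def by simp
    moreover have "?N S + h * (n - s) = h * s + ?N (?V - S)"
      using card_near_pairs_complement[OF V(1,3) S(1)] co s by simp
    ultimately show ?thesis by linarith
  next
    case 3
    have up: "2 * ?N S + 2 * (h * h) \<le> 2 * (h * s) + h * (h - 1)"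
      using near_pairs_complement_bound[OF V(1) S(1), of h h] 3 co s by simp
    \<comment> \<open>Points of \<open>K\<close> have all their \<open>h\<close> near successors in the interval; the last \<open>h\<close>
      points, forming \<open>J\<close>, are pairwise near.  Together these pairs match the bound for \<open>S\<close>.\<close>
    define J where "J = {b + 1 - h..b}"
    define K where "K = {a..<b + 1 - h}"
    have J: "card J = h" "J \<subseteq> ?I" and K: "card K = s - h" "K \<subseteq> ?I" and JK: "J \<inter> K = {}"
      using 3 s ab by (auto simp: J_def K_def)
    have "?V \<inter> arc u v \<subseteq> J" if "u \<in> J" "v \<in> J" "u < v" for u v
      using that by (auto simp: arc_def J_def)
    then have NJ: "2 * ?N J = h * (h - 1)"
      using near_pairs_short_arc[OF V(1,2) subset_trans[OF J(2) IV]] J(1) by simp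
    let ?KI = "Sigma K (\<lambda>u. {u + 1..u + h})"
    have "cyc_dist ?V u v = v - u" if "u \<in> K" "u < v" "v \<le> u + h" for u v
    proof -
      have "?V \<inter> arc u v = {u..<v}" using that ab 3 s by (auto simp: arc_def K_def)
      then show ?thesis by (simp add: cyc_dist_def)
    qed
    then have sub: "near_pairs ?V h J J \<union> ?KI \<subseteq> near_pairs ?V h ?I ?I"
      using J K 3 s by (auto simp: near_pairs_def K_def)
    have "?N J + (s - h) * h = card (near_pairs ?V h J J \<union> ?KI)"
    proof (subst card_Un_disjoint)
      show "near_pairs ?V h J J \<inter> ?KI = {}" using JK by (auto simp: near_pairs_def)
      have "card ?KI = (s - h) * h" using K by (simp add: K_def)
      then show "?N J + (s - h) * h = ?N J + card ?KI" by simp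
    qed (auto simp: J_def K_def)
    also have "\<dots> \<le> ?N ?I" using sub by (intro card_mono) auto
    finally have "?N J + (s - h) * h \<le> ?N ?I" .
    moreover have "(s - h) * h + h * h = h * s"
      using 3 by (simp add: algebra_simps diff_mult_distrib2)
    ultimately show ?thesis using up NJ by linarith
  qed
qed

section \<open>Pairs at a large distance\<close>

definition gap :: "nat \<Rightarrow> nat \<Rightarrow> nat" where
  "gap i j = (i - j) + (j - i)"

lemma card_gap_pairs:
  assumes "finite S" "0 < d"
  shows "card {(i, j). i \<in> S \<and> j \<in> S \<and> gap i j = d} = 2 * card {i \<in> S. i + d \<in> S}"
proof -
  let ?P = "{i \<in> S. i + d \<in> S}"
  have "{(i, j). i \<in> S \<and> j \<in> S \<and> gap i j = d}
      = (\<lambda>i. (i, i + d)) ` ?P \<union> (\<lambda>i. (i + d, i)) ` ?P" (is "?L = ?A \<union> ?B")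
  proof (intro set_eqI iffI)
    fix p assume "p \<in> ?L"
    then obtain i j where p: "p = (i, j)" "i \<in> S" "j \<in> S" "gap i j = d" by auto
    then have "j = i + d \<or> i = j + d" by (auto simp: gap_def)
    then show "p \<in> ?A \<union> ?B" using p by auto
  qed (auto simp: gap_def)
  moreover have "?A \<inter> ?B = {}" using assms(2) by auto
  moreover have "card ?A = card ?P" "card ?B = card ?P"
    by (auto intro!: card_image simp: inj_on_def)
  ultimately show ?thesis using assms(1) by (simp add: card_Un_disjoint)
qed

text \<open>Pigeonhole: the elements of \<open>S\<close> up to \<open>d\<close> and, shifted down by \<open>d\<close>, those
  above \<open>d\<close> are two subsets of \<open>{1..d}\<close> whose sizes add up to \<open>card S\<close>, so they share
  at least \<open>card S - d\<close> elements, each of which starts a pair at distance \<open>d\<close>.  That the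
  shifted set lies in \<open>{1..d}\<close> is where \<open>n \<le> 2 * d\<close> enters.\<close>

lemma gap_pairs_interval_min:
  assumes d: "0 < d" "n \<le> 2 * d" and ab: "1 \<le> a" "a \<le> b" "b \<le> n"
    and S: "S \<subseteq> {1..n}" "card S = card {a..b}"
  shows "card {(i, j). i \<in> {a..b} \<and> j \<in> {a..b} \<and> gap i j = d}
       \<le> card {(i, j). i \<in> S \<and> j \<in> S \<and> gap i j = d}"
proof -
  have finS: "finite S" using S finite_subset by blast
  have "{i \<in> {a..b}. i + d \<in> {a..b}} = {a..<b + 1 - d}" by auto
  then have I: "card {i \<in> {a..b}. i + d \<in> {a..b}} = card {a..b} - d" by simp
  let ?X = "S \<inter> {1..d}" and ?Y = "{i. i + d \<in> S \<and> 0 < i}"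
  have img: "(\<lambda>i. i + d) ` ?Y = S - {1..d}"
  proof (intro set_eqI iffI)
    fix x assume x: "x \<in> S - {1..d}"
    then have "d < x" using S by auto
    then have "x = (x - d) + d" "0 < x - d" by auto
    then show "x \<in> (\<lambda>i. i + d) ` ?Y" using x by (metis (mono_tags, lifting) DiffD1 imageI mem_Collect_eq)
  qed auto
  have "card ?Y = card (S - {1..d})"
    unfolding img[symmetric] by (rule card_image[symmetric]) simp
  then have sum: "card ?X + card ?Y = card S"
    using card_Int_Diff[OF finS, of "{1..d}"] by simp
  have Y: "?Y \<subseteq> {1..d}" using S(1) d by force
  then have finY: "finite ?Y" by (rule finite_subset) simp
  have "card (?X \<union> ?Y) \<le> card {1..d}" using Y by (intro card_mono) auto
  moreover have "card (?X \<union> ?Y) + card (?X \<inter> ?Y) = card S"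
    using card_Un_Int[of ?X ?Y] finY finS sum by simp
  ultimately have "card S - d \<le> card (?X \<inter> ?Y)" by simp
  also have "\<dots> \<le> card {i \<in> S. i + d \<in> S}"
    using finS by (intro card_mono) auto
  finally show ?thesis
    using card_gap_pairs[OF finS d(1)] card_gap_pairs[of "{a..b}" d] d(1) I S(2) by simp
qed

section \<open>Intervals maximise the pair sums of a down-benevolent function\<close>

text \<open>The first sum telescopes to \<open>\<phi> (min d (n - d)) - \<phi> (n div 2)\<close>; the second
  corrects the value at the distances beyond \<open>n / 2\<close>, where \<open>\<phi> d\<close> may lie below
  \<open>\<phi> (n - d)\<close>.  For even \<open>n\<close> and \<open>e = n / 2\<close> the correction is \<open>0\<close>.\<close>

lemma benevolent_decomposition:
  fixes \<phi> :: "nat \<Rightarrow> real"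
  assumes "1 \<le> d" "d < n"
  shows "\<phi> d = \<phi> (n div 2)
      + (\<Sum>h = 1..<n div 2. (\<phi> h - \<phi> (h + 1)) * of_bool (min d (n - d) \<le> h))
      - (\<Sum>e = 1..n div 2. (\<phi> e - \<phi> (n - e)) * of_bool (d = n - e))"
proof -
  define m where "m = n div 2"
  define c where "c = min d (n - d)"
  have c: "1 \<le> c" "c \<le> m" using assms by (auto simp: c_def m_def)
  have "(\<Sum>h = 1..<m. (\<phi> h - \<phi> (h + 1)) * of_bool (c \<le> h)) = (\<Sum>h = c..<m. \<phi> h - \<phi> (h + 1))"
    using c by (intro sum.mono_neutral_cong_right) auto
  also have "\<dots> = \<phi> c - \<phi> m"
    using sum_Suc_diff'[OF c(2), of "\<lambda>i. - \<phi> i"] by simp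
  finally have 1: "(\<Sum>h = 1..<m. (\<phi> h - \<phi> (h + 1)) * of_bool (c \<le> h)) = \<phi> c - \<phi> m" .
  have "(\<Sum>e = 1..m. (\<phi> e - \<phi> (n - e)) * of_bool (d = n - e))
      = (\<Sum>e = 1..m. if e = n - d then \<phi> (n - d) - \<phi> d else 0)"
    using assms by (intro sum.cong) (auto simp: m_def)
  also have "\<dots> = (if n - d \<le> m then \<phi> (n - d) - \<phi> d else 0)"
    using assms by (subst sum.delta) auto
  also have "\<dots> = \<phi> c - \<phi> d"
  proof (cases "n - d \<le> m")
    case True
    then have "n - d \<le> d" by (auto simp: m_def)
    then show ?thesis using True by (simp add: c_def)
  next
    case False
    then have "d \<le> n - d" by (auto simp: m_def)
    then show ?thesis using False by (simp add: c_def)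
  qed
  finally show ?thesis using 1 by (simp add: m_def c_def)
qed

lemma cyc_dist_initial_segment:
  assumes "i \<in> {1..n}" "j \<in> {1..n}"
  shows "cyc_dist {1..n} i j = (if i \<le> j then j - i else n - (i - j))"
proof (cases "i \<le> j")
  case True
  then have "{1..n} \<inter> arc i j = {i..<j}" using assms by (auto simp: arc_def)
  then show ?thesis using True by (simp add: cyc_dist_def)
next
  case False
  then have "{1..n} \<inter> arc i j = {1..n} - {j..<i}" by (auto simp: arc_def)
  moreover have "card ({1..n} - {j..<i}) = card {1..n} - card {j..<i}"
    using assms by (intro card_Diff_subset) auto
  ultimately show ?thesis using False by (simp add: cyc_dist_def)
qed

lemma card_cyclically_near:
  assumes "2 * h < n" "S \<subseteq> {1..n}"
  shows "card {(i, j). i \<in> S \<and> j \<in> S \<and> i \<noteq> j \<and> min (gap i j) (n - gap i j) \<le> h}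
       = 2 * card (near_pairs {1..n} h S S)"
proof -
  have finS: "finite S" using assms(2) finite_subset by blast
  have iff: "min (gap i j) (n - gap i j) \<le> h \<longleftrightarrow>
      cyc_dist {1..n} i j \<le> h \<or> cyc_dist {1..n} j i \<le> h"
    if "i \<in> S" "j \<in> S" "i \<noteq> j" for i j
  proof -
    have ij: "i \<in> {1..n}" "j \<in> {1..n}" using that assms(2) by auto
    show ?thesis
      unfolding cyc_dist_initial_segment[OF ij] cyc_dist_initial_segment[OF ij(2,1)]
      using that(3) by (cases "i < j") (auto simp: gap_def min_le_iff_disj)
  qed
  have "{(i, j). i \<in> S \<and> j \<in> S \<and> i \<noteq> j \<and> min (gap i j) (n - gap i j) \<le> h}
      = near_pairs {1..n} h S S \<union> prod.swap ` near_pairs {1..n} h S S" (is "?L = ?R")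
  proof (intro set_eqI)
    fix p :: "nat \<times> nat"
    obtain i j where p: "p = (i, j)" by (cases p)
    show "p \<in> ?L \<longleftrightarrow> p \<in> ?R"
      unfolding p using iff[of i j] by (auto simp: mem_swap_image near_pairs_def)
  qed
  then show ?thesis using card_near_pairs_sym[of "{1..n}" h S] assms(1) finS by simp
qed

lemma pair_sum_expansion:
  fixes \<phi> :: "nat \<Rightarrow> real"
  assumes "S \<subseteq> {1..n}"
  shows "(\<Sum>(i, j)\<in>offdiag S. \<phi> (gap i j))
    = \<phi> (n div 2) * real (card S * (card S - 1))
      + (\<Sum>h = 1..<n div 2. (\<phi> h - \<phi> (h + 1)) * real (2 * card (near_pairs {1..n} h S S)))
      - (\<Sum>e = 1..n div 2. (\<phi> e - \<phi> (n - e)) *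
           real (card {(i, j). i \<in> S \<and> j \<in> S \<and> gap i j = n - e}))"
proof -
  let ?m = "n div 2"
  have finS: "finite S" using assms finite_subset by blast
  then have fin: "finite (offdiag S)" by simp
  have count: "(\<Sum>p\<in>offdiag S. of_bool (P p)) = real (card {p \<in> offdiag S. P p})" for P
    using fin by (simp add: sum_of_bool_eq Int_def)
  have "(\<Sum>(i, j)\<in>offdiag S. \<phi> (gap i j))
      = (\<Sum>p\<in>offdiag S. \<phi> ?m
        + (\<Sum>h = 1..<?m. (\<phi> h - \<phi> (h + 1)) *
             of_bool (min (gap (fst p) (snd p)) (n - gap (fst p) (snd p)) \<le> h))
        - (\<Sum>e = 1..?m. (\<phi> e - \<phi> (n - e)) * of_bool (gap (fst p) (snd p) = n - e)))"
  proof (rule sum.cong[OF refl], clarify)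
    fix i j assume "(i, j) \<in> offdiag S"
    then have "i \<noteq> j" "i \<in> {1..n}" "j \<in> {1..n}" using assms by (auto simp: offdiag_def)
    then have "1 \<le> gap i j" "gap i j < n" by (auto simp: gap_def)
    from benevolent_decomposition[OF this, of \<phi>]
    show "\<phi> (gap i j) = \<phi> ?m
        + (\<Sum>h = 1..<?m. (\<phi> h - \<phi> (h + 1)) *
             of_bool (min (gap (fst (i, j)) (snd (i, j))) (n - gap (fst (i, j)) (snd (i, j))) \<le> h))
        - (\<Sum>e = 1..?m. (\<phi> e - \<phi> (n - e)) * of_bool (gap (fst (i, j)) (snd (i, j)) = n - e))"
      by simp
  qed
  also have "\<dots> = \<phi> ?m * real (card (offdiag S))
      + (\<Sum>h = 1..<?m. (\<phi> h - \<phi> (h + 1)) *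
           real (card {p \<in> offdiag S. min (gap (fst p) (snd p)) (n - gap (fst p) (snd p)) \<le> h}))
      - (\<Sum>e = 1..?m. (\<phi> e - \<phi> (n - e)) *
           real (card {p \<in> offdiag S. gap (fst p) (snd p) = n - e}))"
    unfolding sum.distrib sum_subtractf count[symmetric] sum_distrib_left
    by (subst (1 2) sum.swap[of _ "offdiag S"]) (simp add: mult.commute)
  also have "(\<Sum>h = 1..<?m. (\<phi> h - \<phi> (h + 1)) *
           real (card {p \<in> offdiag S. min (gap (fst p) (snd p)) (n - gap (fst p) (snd p)) \<le> h}))
      = (\<Sum>h = 1..<?m. (\<phi> h - \<phi> (h + 1)) * real (2 * card (near_pairs {1..n} h S S)))"
  proof (rule sum.cong[OF refl])
    fix h assume "h \<in> {1..<?m}"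
    then have h: "2 * h < n" by auto
    have "{p \<in> offdiag S. min (gap (fst p) (snd p)) (n - gap (fst p) (snd p)) \<le> h}
        = {(i, j). i \<in> S \<and> j \<in> S \<and> i \<noteq> j \<and> min (gap i j) (n - gap i j) \<le> h}"
      by (auto simp: offdiag_def)
    then show "(\<phi> h - \<phi> (h + 1)) *
        real (card {p \<in> offdiag S. min (gap (fst p) (snd p)) (n - gap (fst p) (snd p)) \<le> h})
      = (\<phi> h - \<phi> (h + 1)) * real (2 * card (near_pairs {1..n} h S S))"
      using card_cyclically_near[OF h assms] by simp
  qed
  also have "(\<Sum>e = 1..?m. (\<phi> e - \<phi> (n - e)) *
           real (card {p \<in> offdiag S. gap (fst p) (snd p) = n - e}))
      = (\<Sum>e = 1..?m. (\<phi> e - \<phi> (n - e)) *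
           real (card {(i, j). i \<in> S \<and> j \<in> S \<and> gap i j = n - e}))"
  proof (rule sum.cong[OF refl])
    fix e assume "e \<in> {1..?m}"
    then have "0 < n - e" by auto
    then have "{p \<in> offdiag S. gap (fst p) (snd p) = n - e}
        = {(i, j). i \<in> S \<and> j \<in> S \<and> gap i j = n - e}"
      by (auto simp: offdiag_def gap_def)
    then show "(\<phi> e - \<phi> (n - e)) * real (card {p \<in> offdiag S. gap (fst p) (snd p) = n - e})
      = (\<phi> e - \<phi> (n - e)) * real (card {(i, j). i \<in> S \<and> j \<in> S \<and> gap i j = n - e})"
      by simp
  qed
  finally show ?thesis by (simp add: card_offdiag[OF finS])
qed

text \<open>In \<open>pair_sum_expansion\<close> all coefficients of counts are nonnegative and the
  constant part depends on the size of the set only, so the two extremal counting results apply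
  term by term.\<close>

lemma pair_sum_interval_max:
  fixes \<phi> :: "nat \<Rightarrow> real"
  assumes dec: "\<And>d. 1 \<le> d \<Longrightarrow> d + 1 \<le> n div 2 \<Longrightarrow> \<phi> (d + 1) \<le> \<phi> d"
    and ben: "\<And>d. 1 \<le> d \<Longrightarrow> d \<le> n div 2 \<Longrightarrow> \<phi> (n - d) \<le> \<phi> d"
    and ab: "1 \<le> a" "a \<le> b" "b \<le> n"
    and S: "S \<subseteq> {1..n}" "card S = card {a..b}"
  shows "(\<Sum>(i, j)\<in>offdiag S. \<phi> (gap i j)) \<le> (\<Sum>(i, j)\<in>offdiag {a..b}. \<phi> (gap i j))"
proof -
  have IV: "{a..b} \<subseteq> {1..n}" using ab by auto
  show ?thesis
    unfolding pair_sum_expansion[OF S(1)] pair_sum_expansion[OF IV] S(2)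
  proof (intro diff_mono add_left_mono sum_mono mult_left_mono)
    fix h assume "h \<in> {1..<n div 2}"
    then have "2 * h < n" by auto
    from near_pairs_interval_max[OF this ab S]
    show "real (2 * card (near_pairs {1..n} h S S))
        \<le> real (2 * card (near_pairs {1..n} h {a..b} {a..b}))" by simp
  next
    fix h assume "h \<in> {1..<n div 2}"
    then show "0 \<le> \<phi> h - \<phi> (h + 1)" using dec[of h] by simp
  next
    fix e assume "e \<in> {1..n div 2}"
    then have "0 < n - e" "n \<le> 2 * (n - e)" by auto
    from gap_pairs_interval_min[OF this ab S]
    show "real (card {(i, j). i \<in> {a..b} \<and> j \<in> {a..b} \<and> gap i j = n - e})
        \<le> real (card {(i, j). i \<in> S \<and> j \<in> S \<and> gap i j = n - e})" by simp
  next
    fix e assume "e \<in> {1..n div 2}"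
    then show "0 \<le> \<phi> e - \<phi> (n - e)" using ben[of e] by simp
  qed
qed

lemma down_benevolent_toeplitz_gap:
  assumes "down_benevolent_toeplitz n B"
  obtains \<phi> :: "nat \<Rightarrow> real" where "\<phi> 0 = 0"
    and "\<And>d. 1 \<le> d \<Longrightarrow> d + 1 \<le> n div 2 \<Longrightarrow> \<phi> (d + 1) \<le> \<phi> d"
    and "\<And>d. 1 \<le> d \<Longrightarrow> d \<le> n div 2 \<Longrightarrow> \<phi> (n - d) \<le> \<phi> d"
    and "\<And>i j. i \<in> {1..n} \<Longrightarrow> j \<in> {1..n} \<Longrightarrow> B i j = \<phi> (gap i j)"
proof -
  obtain f where sym: "symmetric_matrix n B" and toep: "toeplitz_matrix n f B"
    and f: "down_benevolent_function n f"
    using assms by (auto simp: down_benevolent_toeplitz_def)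
  have ceil: "\<lceil>(real n - 1) / 2\<rceil> = int (n div 2)"
  proof (rule ceiling_unique)
    show "real_of_int (int (n div 2)) - 1 < (real n - 1) / 2"
      by (cases "even n") (auto elim!: evenE oddE)
    show "(real n - 1) / 2 \<le> real_of_int (int (n div 2))"
      by (cases "even n") (auto elim!: evenE oddE)
  qed
  note f' = f[unfolded down_benevolent_function_def ceil]
  show thesis
  proof (rule that[of "\<lambda>d. f (int d)"])
    show "f (int 0) = 0" using f' by simp
    show "f (int (d + 1)) \<le> f (int d)" if "1 \<le> d" "d + 1 \<le> n div 2" for d
    proof -
      have "1 \<le> int d" "int d + 1 \<le> int (n div 2)" using that by linarith+
      then have "f (int d) \<ge> f (int d + 1)" using f' by blast
      then show ?thesis by (simp add: add.commute)
    qed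
    show "f (int (n - d)) \<le> f (int d)" if "1 \<le> d" "d \<le> n div 2" for d
    proof -
      have "1 \<le> int d" "int d \<le> int (n div 2)" using that by linarith+
      then have "f (int n - int d) \<le> f (int d)" using f' by blast
      moreover have "int (n - d) = int n - int d" using that by simp
      ultimately show ?thesis by simp
    qed
    show "B i j = f (int (gap i j))" if ij: "i \<in> {1..n}" "j \<in> {1..n}" for i j
    proof (cases "j \<le> i")
      case True
      then have "int (gap i j) = int i - int j" by (simp add: gap_def)
      then show ?thesis using toep ij by (simp add: toeplitz_matrix_def)
    next
      case False
      then have "int (gap i j) = int j - int i" by (simp add: gap_def)
      moreover have "B i j = B j i" using sym ij by (simp add: symmetric_matrix_def)
      ultimately show ?thesis using toep ij by (simp add: toeplitz_matrix_def)
    qed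
  qed
qed

section \<open>Robinson Kalmanson matrices as combinations of intervals\<close>

lemma double_telescope:
  fixes C :: "nat \<Rightarrow> nat \<Rightarrow> real"
  assumes "i \<le> n" "j \<le> n" "\<And>b. C 0 b = 0" "\<And>a. C a (Suc n) = 0"
  shows "(\<Sum>a = 1..i. \<Sum>b = j..n. C a b - C (a - 1) b - C a (b + 1) + C (a - 1) (b + 1)) = C i j"
proof -
  have "(\<Sum>b = j..n. C a b - C (a - 1) b - C a (b + 1) + C (a - 1) (b + 1))
      = C a j - C (a - 1) j" for a
    using sum_Suc_diff[of j n "\<lambda>b. C (a - 1) b - C a b"] assms(2,4)
    by (simp add: algebra_simps sum.distrib sum_subtractf)
  then have "(\<Sum>a = 1..i. \<Sum>b = j..n. C a b - C (a - 1) b - C a (b + 1) + C (a - 1) (b + 1))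
      = (\<Sum>a = 1..i. C a j - C (a - 1) j)" by simp
  also have "\<dots> = C i j"
    using sum_telescope''[of 0 i "\<lambda>a. C a j"] assms(3) by simp
  finally show ?thesis .
qed

text \<open>The matrix of \<open>A 1 n - A i j\<close>, bordered by zeros above and to the right, is the double
  partial sum of its mixed differences \<open>w\<close>: the value at \<open>i < j\<close> collects the weights of all
  intervals \<open>{a..b}\<close> with \<open>a \<le> i\<close> and \<open>j \<le> b\<close>.  In the interior, \<open>0 \<le> w a b\<close>
  is the second Kalmanson inequality for \<open>a - 1, a, b, b + 1\<close>; on the border it is a
  Robinson inequality, and \<open>w 1 n = 0\<close>.\<close>

lemma robinson_kalmanson_interval_decomposition:
  assumes R: "robinson_matrix n A" and K: "kalmanson_matrix n A"
  obtains c :: real and w :: "nat \<Rightarrow> nat \<Rightarrow> real" where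
    "\<And>a b. 1 \<le> a \<Longrightarrow> a < b \<Longrightarrow> b \<le> n \<Longrightarrow> 0 \<le> w a b"
    and "\<And>i j. i \<in> {1..n} \<Longrightarrow> j \<in> {1..n} \<Longrightarrow> i \<noteq> j \<Longrightarrow>
      A i j = c - (\<Sum>a = 1..n. \<Sum>b = a + 1..n. w a b * of_bool (i \<in> {a..b} \<and> j \<in> {a..b}))"
proof -
  define C where "C a b = (if a = 0 \<or> n < b then 0 else A 1 n - A a b)" for a b
  define w where "w a b = C a b - C (a - 1) b - C a (b + 1) + C (a - 1) (b + 1)" for a b
  have rob: "A i k \<ge> A i j" "A i k \<ge> A j k" if "1 \<le> i" "i < j" "j < k" "k \<le> n" for i j k
    using R that by (auto simp: robinson_matrix_def)
  have sym: "A i j = A j i" if "i \<in> {1..n}" "j \<in> {1..n}" for i j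
    using R that by (auto simp: robinson_matrix_def symmetric_matrix_def)
  have nonneg: "0 \<le> w a b" if ab: "1 \<le> a" "a < b" "b \<le> n" for a b
  proof -
    consider "a = 1" "b = n" | "a = 1" "b < n" | "1 < a" "b = n" | "1 < a" "b < n"
      using ab by linarith
    then show ?thesis
    proof cases
      case 1
      then show ?thesis by (simp add: w_def C_def)
    next
      case 2
      then show ?thesis using rob(1)[of 1 b "b + 1"] ab by (simp add: w_def C_def)
    next
      case 3
      then show ?thesis using rob(2)[of "a - 1" a n] ab by (simp add: w_def C_def)
    next
      case 4
      then have *: "1 \<le> a - 1" "a - 1 < a" "b < b + 1" "b + 1 \<le> n" by auto
      have "A (a - 1) b + A a (b + 1) \<ge> A (a - 1) (b + 1) + A a b"
        using K * ab(2) unfolding kalmanson_matrix_def by blast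
      then show ?thesis using 4 ab by (auto simp: w_def C_def)
    qed
  qed
  have upper: "A i j = A 1 n - (\<Sum>a = 1..n. \<Sum>b = a + 1..n. w a b * of_bool (i \<in> {a..b} \<and> j \<in> {a..b}))"
    if ij: "1 \<le> i" "i < j" "j \<le> n" for i j
  proof -
    have "(\<Sum>b = a + 1..n. w a b * of_bool (i \<in> {a..b} \<and> j \<in> {a..b}))
        = of_bool (a \<le> i) * (\<Sum>b = j..n. w a b)" for a
    proof (cases "a \<le> i")
      case True
      have "(\<Sum>b = a + 1..n. w a b * of_bool (i \<in> {a..b} \<and> j \<in> {a..b})) = (\<Sum>b = j..n. w a b)"
        using True ij by (intro sum.mono_neutral_cong_right) auto
      then show ?thesis using True by simp
    qed simp
    then have "(\<Sum>a = 1..n. \<Sum>b = a + 1..n. w a b * of_bool (i \<in> {a..b} \<and> j \<in> {a..b}))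
        = (\<Sum>a = 1..n. of_bool (a \<le> i) * (\<Sum>b = j..n. w a b))" by simp
    also have "\<dots> = (\<Sum>a = 1..i. \<Sum>b = j..n. w a b)"
      using ij by (intro sum.mono_neutral_cong_right) auto
    also have "\<dots> = C i j"
      unfolding w_def using ij by (intro double_telescope) (auto simp: C_def)
    finally show ?thesis using ij by (simp add: C_def)
  qed
  show thesis
  proof (rule that[of w "A 1 n"])
    fix i j assume ij: "i \<in> {1..n}" "j \<in> {1..n}" "i \<noteq> j"
    show "A i j = A 1 n - (\<Sum>a = 1..n. \<Sum>b = a + 1..n. w a b * of_bool (i \<in> {a..b} \<and> j \<in> {a..b}))"
    proof (cases "i < j")
      case True
      then show ?thesis using upper[of i j] ij by simp
    next
      case False
      then have "A j i = A 1 n - (\<Sum>a = 1..n. \<Sum>b = a + 1..n. w a b * of_bool (j \<in> {a..b} \<and> i \<in> {a..b}))"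
        using upper[of j i] ij by simp
      then show ?thesis using sym[OF ij(1,2)] by (simp only: conj_commute)
    qed
  qed (rule nonneg)
qed

lemma qap_cost_interval_decomposition:
  assumes perm: "\<sigma> permutes {1..n}"
    and A: "\<And>i j. i \<in> {1..n} \<Longrightarrow> j \<in> {1..n} \<Longrightarrow> i \<noteq> j \<Longrightarrow>
      A i j = c - (\<Sum>a = 1..n. \<Sum>b = a + 1..n. w a b * of_bool (i \<in> {a..b} \<and> j \<in> {a..b}))"
    and B: "\<And>i. i \<in> {1..n} \<Longrightarrow> B i i = 0"
  shows "qap_cost n A B \<sigma> = c * (\<Sum>(i, j)\<in>offdiag {1..n}. B i j)
    - (\<Sum>a = 1..n. \<Sum>b = a + 1..n. w a b * (\<Sum>(i, j)\<in>offdiag (\<sigma> -` {a..b}). B i j))"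
proof -
  let ?O = "offdiag {1..n}"
  let ?X = "\<lambda>a b. \<Sum>p\<in>?O. of_bool (\<sigma> (fst p) \<in> {a..b} \<and> \<sigma> (snd p) \<in> {a..b}) * B (fst p) (snd p)"
  let ?Y = "\<lambda>a b. \<Sum>(i, j)\<in>offdiag (\<sigma> -` {a..b}). B i j"
  have "qap_cost n A B \<sigma> = (\<Sum>(i, j)\<in>{1..n} \<times> {1..n}. A (\<sigma> i) (\<sigma> j) * B i j)"
    by (simp add: qap_cost_def sum.cartesian_product)
  also have "\<dots> = (\<Sum>(i, j)\<in>?O. A (\<sigma> i) (\<sigma> j) * B i j)"
    by (rule sum.mono_neutral_right) (auto simp: offdiag_def B)
  also have "\<dots> = (\<Sum>p\<in>?O. c * B (fst p) (snd p)
      - (\<Sum>a = 1..n. \<Sum>b = a + 1..n. w a b *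
          (of_bool (\<sigma> (fst p) \<in> {a..b} \<and> \<sigma> (snd p) \<in> {a..b}) * B (fst p) (snd p))))"
  proof (rule sum.cong[OF refl], clarify)
    fix i j assume "(i, j) \<in> ?O"
    then have "\<sigma> i \<in> {1..n}" "\<sigma> j \<in> {1..n}" "\<sigma> i \<noteq> \<sigma> j"
      using permutes_in_image[OF perm] permutes_inj[OF perm] by (auto simp: offdiag_def inj_def)
    from A[OF this]
    show "A (\<sigma> i) (\<sigma> j) * B i j = c * B (fst (i, j)) (snd (i, j))
      - (\<Sum>a = 1..n. \<Sum>b = a + 1..n. w a b *
          (of_bool (\<sigma> (fst (i, j)) \<in> {a..b} \<and> \<sigma> (snd (i, j)) \<in> {a..b}) * B (fst (i, j)) (snd (i, j))))"
      by (simp only: left_diff_distrib sum_distrib_right mult.assoc fst_conv snd_conv)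
  qed
  also have "\<dots> = c * (\<Sum>(i, j)\<in>?O. B i j)
      - (\<Sum>a = 1..n. \<Sum>b = a + 1..n. w a b * ?X a b)"
    unfolding sum_subtractf sum_distrib_left
    by (subst sum.swap[of _ "?O"], subst sum.swap[of _ "?O"]) (simp add: case_prod_beta)
  also have "(\<Sum>a = 1..n. \<Sum>b = a + 1..n. w a b * ?X a b)
      = (\<Sum>a = 1..n. \<Sum>b = a + 1..n. w a b * ?Y a b)"
  proof (rule sum.cong[OF refl], rule sum.cong[OF refl])
    fix a b assume "a \<in> {1..n}" "b \<in> {a + 1..n}"
    then have "\<sigma> -` {a..b} \<subseteq> {1..n}"
      using permutes_in_image[OF perm] by fastforce
    then have "?X a b = (\<Sum>p\<in>offdiag (\<sigma> -` {a..b}). B (fst p) (snd p))"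
      by (intro sum.mono_neutral_cong_right finite_offdiag finite_atLeastAtMost)
        (auto simp: offdiag_def)
    then show "w a b * ?X a b = w a b * ?Y a b"
      by (simp add: case_prod_beta)
  qed
  finally show ?thesis .
qed

theorem theorem3p4:
  fixes n :: nat and A B :: "nat \<Rightarrow> nat \<Rightarrow> real"
  assumes "robinson_matrix n A"
    and "kalmanson_matrix n A"
    and "down_benevolent_toeplitz n B"
  shows "qap_optimal n A B id"
proof -
  obtain c w where w: "\<And>a b. 1 \<le> a \<Longrightarrow> a < b \<Longrightarrow> b \<le> n \<Longrightarrow> 0 \<le> w a b"
    and A: "\<And>i j. i \<in> {1..n} \<Longrightarrow> j \<in> {1..n} \<Longrightarrow> i \<noteq> j \<Longrightarrow>
      A i j = c - (\<Sum>a = 1..n. \<Sum>b = a + 1..n. w a b * of_bool (i \<in> {a..b} \<and> j \<in> {a..b}))"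
    by (rule robinson_kalmanson_interval_decomposition[OF assms(1,2)]) (rule that)
  obtain \<phi> where phi0: "\<phi> 0 = (0 :: real)"
    and dec: "\<And>d. 1 \<le> d \<Longrightarrow> d + 1 \<le> n div 2 \<Longrightarrow> \<phi> (d + 1) \<le> \<phi> d"
    and ben: "\<And>d. 1 \<le> d \<Longrightarrow> d \<le> n div 2 \<Longrightarrow> \<phi> (n - d) \<le> \<phi> d"
    and B: "\<And>i j. i \<in> {1..n} \<Longrightarrow> j \<in> {1..n} \<Longrightarrow> B i j = \<phi> (gap i j)"
    by (rule down_benevolent_toeplitz_gap[OF assms(3)]) (rule that)
  have diag: "B i i = 0" if "i \<in> {1..n}" for i
    using B[OF that that] phi0 by (simp add: gap_def)
  have cost: "qap_cost n A B \<tau> = c * (\<Sum>(i, j)\<in>offdiag {1..n}. B i j)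
      - (\<Sum>a = 1..n. \<Sum>b = a + 1..n. w a b * (\<Sum>(i, j)\<in>offdiag (\<tau> -` {a..b}). B i j))"
    if "\<tau> permutes {1..n}" for \<tau>
    by (rule qap_cost_interval_decomposition[OF that]) (rule A diag; assumption)+
  have "qap_cost n A B id \<le> qap_cost n A B \<sigma>" if perm: "\<sigma> permutes {1..n}" for \<sigma>
  proof -
    have le: "(\<Sum>(i, j)\<in>offdiag (\<sigma> -` {a..b}). B i j) \<le> (\<Sum>(i, j)\<in>offdiag (id -` {a..b}). B i j)"
      if ab: "1 \<le> a" "a < b" "b \<le> n" for a b
    proof -
      let ?S = "\<sigma> -` {a..b}"
      have sub: "?S \<subseteq> {1..n}" "{a..b} \<subseteq> {1..n}"
        using permutes_in_image[OF perm] ab by fastforce+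
      have card: "card ?S = card {a..b}"
        using permutes_inj[OF perm] permutes_surj[OF perm] by (simp add: card_vimage_inj)
      have eq: "(\<Sum>(i, j)\<in>offdiag T. B i j) = (\<Sum>(i, j)\<in>offdiag T. \<phi> (gap i j))"
        if "T \<subseteq> {1..n}" for T
        using that by (intro sum.cong) (auto simp: offdiag_def B subset_iff)
      show ?thesis
        using pair_sum_interval_max[OF dec ben ab(1) less_imp_le[OF ab(2)] ab(3) sub(1) card]
          eq[OF sub(1)] eq[OF sub(2)] by simp
    qed
    show ?thesis
      unfolding cost[OF perm] cost[OF permutes_id]
      using le w by (intro diff_left_mono sum_mono mult_left_mono) auto
  qed
  then show ?thesis by (simp add: qap_optimal_def permutes_id)
qed

end
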